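(* Let $f$ be a probability density on $\mathbb{X}$ and let $k:\mathbb{X}\times\Theta\to[0,\infty)$ be a kernel such that $k(\cdot,\theta)$ is a probability density on $\mathbb{X}$ for each $\theta\in\Theta$. Let $p_0$ be a probability density on $\Theta$ with $p_0>0$, and define iteratively, for $m\ge 1$, $$p_m(\theta)=p_{m-1}(\theta)\int_{\mathbb{X}}\frac{k(x,\theta)\,f(x)}{f_{m-1}(x)}\,dx,\qquad\text{where } f_m(x)=\int_\Theta k(x,\theta)\,p_m(\theta)\,d\theta \quad (m\ge 0).$$ For $m\ge 0$ set $q_m(x,\theta)=p_m(\theta)\,k(x,\theta)$. Assume there exists a sequence $(p^*_s)_{s\ge 1}$ of probability densities on $\Theta$ such that, with $$f^*_s(x)=\int_\Theta k(x,\theta)\,p^*_s(\theta)\,d\theta,\qquad \pi^*_s(x,\theta)=\frac{f(x)\,p^*_s(\theta)\,k(x,\theta)}{\int_\Theta p^*_s(\theta')\,k(x,\theta')\,d\theta'},$$ one has (i) $D(f,f^*_s)\to\inf_P D(f,f_P)$ as $s\to\infty$, and (ii) for each $s\ge 1$, $D(\pi^*_s,q_m)<\infty$ for some $m\ge 0$, where the infimum is over all probability measures $P$ on $\Theta$ and $f_P(x)=\int_\Theta k(x,\theta)\,dP(\theta)$. Then $D(f,f_m)$ decreases to $\inf_P D(f,f_P)$; that is, the sequence $(D(f,f_m))_{m\ge 0}$ is non-increasing and $\lim_{m\to\infty}D(f,f_m)=\inf_P D(f,f_P)$.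
   Context: $\mathbb{X}\subset\mathbb{R}$ is a measurable set with Lebesgue measure $dx$; $\Theta$ is a measurable subset of a Euclidean space with Lebesgue measure $d\theta$; $k$ is jointly measurable. "Density" means probability density with respect to the corresponding Lebesgue measure (on $\mathbb{X}\times\Theta$, with respect to $dx\,d\theta$). For two probability densities $g,h$ on the same space with dominating measure $\mu$, $D(g,h)=\int g\log(g/h)\,d\mu\in[0,\infty]$ denotes the Kullback–Leibler divergence. It is used both for densities on $\mathbb{X}$ (with $d\mu=dx$) and for joint densities on $\mathbb{X}\times\Theta$ (with $d\mu=dx\,d\theta$). The functions $f_0$ and the ratios above are understood to be well-defined: $f_0>0$ and $f_s^*>0$ (for all $s$) almost everywhere on $\{f>0\}$, and ratios with numerator factor $f(x)=0$ are taken to be $0$. With this, each $p_m$ is again a probability density on $\Theta$. No existence of a density $p$ solving $f(x)=\int_\Theta k(x,\theta)p(\theta)\,d\theta$ is assumed. *)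

theory Defs
  imports "HOL-Probability.Probability"
begin

abbreviation lborel_on :: "'a::euclidean_space set \<Rightarrow> 'a measure" where
  "lborel_on S \<equiv> restrict_space lborel S"

text \<open>
  Densities take values in \<^typ>\<open>ennreal\<close>, because the integrals defining the iterates below may be
  infinite on null sets. In \<^typ>\<open>ennreal\<close>, \<open>0 / b = 0\<close> for every \<open>b\<close> (including \<open>b = 0\<close>), which is
  the convention that ratios with a vanishing numerator factor are 0.
\<close>

definition prob_density :: "'a measure \<Rightarrow> ('a \<Rightarrow> ennreal) \<Rightarrow> bool" where
  "prob_density M g \<longleftrightarrow> g \<in> borel_measurable M \<and> (\<integral>\<^sup>+ x. g x \<partial>M) = 1"

text \<open>
  The integrand \<open>a log (a / b)\<close> of the Kullback--Leibler divergence, with the usual conventions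
  \<open>0 log (0 / b) = 0\<close> and \<open>a log (a / 0) = \<infinity>\<close> for \<open>a > 0\<close>; these are spelled out since \<open>ln 0 = 0\<close>
  for reals. The values at \<open>a = \<infinity>\<close> and \<open>b = \<infinity>\<close> are irrelevant: densities are finite almost
  everywhere.
\<close>

definition kl_integrand :: "ennreal \<Rightarrow> ennreal \<Rightarrow> ereal" where
  "kl_integrand a b =
     (if a = 0 then 0
      else if b = 0 then \<infinity>
      else ereal (enn2real a * ln (enn2real a / enn2real b)))"

text \<open>
  The extended-valued integral is the integral of the positive part minus that of the negative part
  (\<^const>\<open>e2ennreal\<close> maps negative numbers to 0). For probability densities the latter is finite,
  since \<open>a log (a / b) \<ge> a - b\<close>, so the difference is never \<open>\<infinity> - \<infinity>\<close>. The real-valued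
  divergence of HOL-Probability is not suitable because its value is 0 if the integral diverges.
\<close>

definition kl_div :: "'a measure \<Rightarrow> ('a \<Rightarrow> ennreal) \<Rightarrow> ('a \<Rightarrow> ennreal) \<Rightarrow> ereal" where
  "kl_div M g h =
     enn2ereal (\<integral>\<^sup>+ x. e2ennreal (kl_integrand (g x) (h x)) \<partial>M)
     - enn2ereal (\<integral>\<^sup>+ x. e2ennreal (- kl_integrand (g x) (h x)) \<partial>M)"

text \<open>\<open>f\<^sub>P\<close> for a measure \<open>P\<close>, and its analogue for a density \<open>p\<close> with respect to \<open>N\<close>.\<close>

definition mixture :: "('a \<Rightarrow> 'b \<Rightarrow> ennreal) \<Rightarrow> 'b measure \<Rightarrow> 'a \<Rightarrow> ennreal" where
  "mixture k P x = (\<integral>\<^sup>+ \<theta>. k x \<theta> \<partial>P)"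

definition mixture_dens ::
    "'b measure \<Rightarrow> ('a \<Rightarrow> 'b \<Rightarrow> ennreal) \<Rightarrow> ('b \<Rightarrow> ennreal) \<Rightarrow> 'a \<Rightarrow> ennreal" where
  "mixture_dens N k p x = (\<integral>\<^sup>+ \<theta>. k x \<theta> * p \<theta> \<partial>N)"

primrec p_iter ::
    "'a measure \<Rightarrow> 'b measure \<Rightarrow> ('a \<Rightarrow> 'b \<Rightarrow> ennreal) \<Rightarrow> ('a \<Rightarrow> ennreal) \<Rightarrow> ('b \<Rightarrow> ennreal)
      \<Rightarrow> nat \<Rightarrow> 'b \<Rightarrow> ennreal" where
  "p_iter M N k f p0 0 = p0"
| "p_iter M N k f p0 (Suc m) =
     (\<lambda>\<theta>. p_iter M N k f p0 m \<theta> *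
           (\<integral>\<^sup>+ x. k x \<theta> * f x / mixture_dens N k (p_iter M N k f p0 m) x \<partial>M))"

definition f_iter ::
    "'a measure \<Rightarrow> 'b measure \<Rightarrow> ('a \<Rightarrow> 'b \<Rightarrow> ennreal) \<Rightarrow> ('a \<Rightarrow> ennreal) \<Rightarrow> ('b \<Rightarrow> ennreal)
      \<Rightarrow> nat \<Rightarrow> 'a \<Rightarrow> ennreal" where
  "f_iter M N k f p0 m = mixture_dens N k (p_iter M N k f p0 m)"

definition q_iter ::
    "'a measure \<Rightarrow> 'b measure \<Rightarrow> ('a \<Rightarrow> 'b \<Rightarrow> ennreal) \<Rightarrow> ('a \<Rightarrow> ennreal) \<Rightarrow> ('b \<Rightarrow> ennreal)
      \<Rightarrow> nat \<Rightarrow> 'a \<times> 'b \<Rightarrow> ennreal" where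
  "q_iter M N k f p0 m = (\<lambda>(x, \<theta>). p_iter M N k f p0 m \<theta> * k x \<theta>)"

definition pi_star ::
    "'b measure \<Rightarrow> ('a \<Rightarrow> 'b \<Rightarrow> ennreal) \<Rightarrow> ('a \<Rightarrow> ennreal) \<Rightarrow> ('b \<Rightarrow> ennreal)
      \<Rightarrow> 'a \<times> 'b \<Rightarrow> ennreal" where
  "pi_star N k f p = (\<lambda>(x, \<theta>). f x * p \<theta> * k x \<theta> / mixture_dens N k p x)"

definition prob_measures_on :: "'a::topological_space set \<Rightarrow> 'a measure set" where
  "prob_measures_on S = {P. prob_space P \<and> sets P = sets (restrict_space borel S)}"

definition inf_kl ::
    "real set \<Rightarrow> 'a::euclidean_space set \<Rightarrow> (real \<Rightarrow> 'a \<Rightarrow> ennreal) \<Rightarrow> (real \<Rightarrow> ennreal) \<Rightarrow> ereal" where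
  "inf_kl X \<Theta> k f = (INF P \<in> prob_measures_on \<Theta>. kl_div (lborel_on X) f (mixture k P))"

end

theory Submission
  imports Defs
begin

text \<open>
  The iteration is alternating minimisation of \<open>D(\<pi>, q)\<close> over joint densities \<open>\<pi>\<close> with marginal \<open>f\<close>
  and joint densities \<open>q = p k\<close>. For densities \<open>p\<close>, \<open>q\<close> on \<open>\<Theta>\<close> with mixtures \<open>f\<^sub>p\<close>, \<open>f\<^sub>q\<close>, let
  \<open>\<pi>\<^sub>p = f p k / f\<^sub>p\<close>, \<open>r = \<integral> k f / f\<^sub>q dx\<close> and \<open>q' = q r\<close> the update of \<open>q\<close>. Two inequalities suffice:
  \<open>D(f, f\<^sub>q) \<le> D(\<pi>\<^sub>p, q k)\<close> and
  \<open>D(\<pi>\<^sub>p, q' k) + D(f, f\<^sub>q) \<le> D(\<pi>\<^sub>p, q k) + D(f, f\<^sub>p)\<close>.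
  In both, the logarithms under \<open>\<pi>\<^sub>p\<close> differ by \<open>log u\<close>, with \<open>u = \<pi>\<^sub>q / \<pi>\<^sub>p\<close> and
  \<open>u = f\<^sub>p / (f\<^sub>q r)\<close> respectively; as \<open>\<integral> u \<pi>\<^sub>p \<le> 1\<close>, the bound \<open>log u \<le> u - 1\<close> gives the claim.
  Taking \<open>p = q\<close> yields monotonicity. Taking \<open>p = p\<^sup>*\<^sub>s\<close> and telescoping the second inequality from
  an index \<open>m\<close> with \<open>D(\<pi>\<^sup>*\<^sub>s, q\<^sub>m)\<close> finite yields \<open>n (lim D(f, f\<^sub>j) - D(f, f\<^sup>*\<^sub>s)) \<le> D(\<pi>\<^sup>*\<^sub>s, q\<^sub>m)\<close> for
  all \<open>n\<close>, so that \<open>lim D(f, f\<^sub>j) \<le> D(f, f\<^sup>*\<^sub>s)\<close>.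
\<close>

section \<open>The divergence as an integral of the log-likelihood ratio\<close>

text \<open>The log-ratio is real-valued so that Bochner integrals apply. Its junk values where
  \<open>g\<close> or \<open>h\<close> vanishes or is infinite do no harm: it is integrated against
  \<open>density M g\<close> with \<open>h\<close> positive almost everywhere on
  \<open>0 < g x\<close>.\<close>

definition llr :: "('a \<Rightarrow> ennreal) \<Rightarrow> ('a \<Rightarrow> ennreal) \<Rightarrow> 'a \<Rightarrow> real" where
  "llr g h x = ln (enn2real (g x) / enn2real (h x))"

lemma measurable_llr[measurable]:
  assumes [measurable]: "g \<in> borel_measurable M" "h \<in> borel_measurable M"
  shows "llr g h \<in> borel_measurable M"
  unfolding llr_def by measurable

lemma AE_finite_of_nn_integral_le_1:
  assumes "h \<in> borel_measurable M" "(\<integral>\<^sup>+x. h x \<partial>M) \<le> 1"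
  shows "AE x in M. h x < (\<infinity>::ennreal)"
proof -
  have "(\<integral>\<^sup>+x. h x \<partial>M) \<noteq> \<infinity>"
    using assms(2) by (auto simp: top_unique)
  then show ?thesis
    using nn_integral_noteq_infinite[OF assms(1)] by (auto simp: less_top)
qed

text \<open>The product is 1 for finite nonzero \<open>a\<close>, and 0 at \<open>0\<close> and
  \<open>top\<close>. Cancelling a denominator therefore costs an inequality but no positivity
  assumption.\<close>

lemma mult_inverse_le_1_ennreal: "(a::ennreal) * inverse a \<le> 1"
  using ennreal_divide_self[of a] by (cases "a = 0 \<or> a = top") (auto simp: divide_ennreal_def less_top)

lemma mult_inverse_cancel_le_ennreal: "(b::ennreal) * (a * inverse a) \<le> b"
  using mult_left_mono[OF mult_inverse_le_1_ennreal[of a], of b] by simp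

text \<open>The excess \<open>u - 1\<close> has nonpositive mean. Integrability of \<open>A\<close>
  comes out as well: its positive part is dominated by that of the integrable right-hand side, and
  its negative part is controlled by \<open>neg\<close>.\<close>

lemma (in prob_space) integral_le_of_excess:
  fixes A B :: "'a \<Rightarrow> real" and u :: "'a \<Rightarrow> ennreal"
  assumes B: "integrable M B"
    and A[measurable]: "A \<in> borel_measurable M" and neg: "(\<integral>\<^sup>+x. ennreal (- A x) \<partial>M) < \<infinity>"
    and u[measurable]: "u \<in> borel_measurable M" and u1: "(\<integral>\<^sup>+x. u x \<partial>M) \<le> 1"
    and le: "AE x in M. A x \<le> B x + (enn2real (u x) - 1)"
  shows "integrable M A" "expectation A \<le> expectation B"
proof -
  have fin: "AE x in M. ennreal (enn2real (u x)) = u x"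
    using AE_finite_of_nn_integral_le_1[OF u u1] by eventually_elim simp
  have nu: "(\<integral>\<^sup>+x. ennreal (enn2real (u x)) \<partial>M) = (\<integral>\<^sup>+x. u x \<partial>M)"
    using fin by (rule nn_integral_cong_AE)
  have iu: "integrable M (\<lambda>x. enn2real (u x))"
    using u1 by (intro integrableI_nonneg) (auto simp: nu intro: le_less_trans)
  have "ennreal (expectation (\<lambda>x. enn2real (u x))) \<le> 1"
    using nn_integral_eq_integral[OF iu] nu u1 by simp
  then have eu: "expectation (\<lambda>x. enn2real (u x)) \<le> 1"
    by simp
  have iR: "integrable M (\<lambda>x. B x + (enn2real (u x) - 1))"
    using B iu by simp
  have "(\<integral>\<^sup>+x. ennreal (A x) \<partial>M) \<le> (\<integral>\<^sup>+x. ennreal (B x + (enn2real (u x) - 1)) \<partial>M)"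
    using le by (intro nn_integral_mono_AE) (auto elim!: eventually_mono intro: ennreal_leI)
  also have "\<dots> < \<infinity>"
    using iR unfolding real_integrable_def by (simp add: less_top)
  finally show iA: "integrable M A"
    using neg unfolding real_integrable_def by (simp add: less_top)
  have "expectation A \<le> expectation (\<lambda>x. B x + (enn2real (u x) - 1))"
    by (rule integral_mono_AE[OF iA iR le])
  also have "\<dots> = expectation B + (expectation (\<lambda>x. enn2real (u x)) - 1)"
    using B iu by (simp add: prob_space)
  finally show "expectation A \<le> expectation B"
    using eu by simp
qed

lemma prob_space_density_of_prob_density:
  "prob_density M g \<Longrightarrow> prob_space (density M g)"
  by (auto simp: prob_density_def emeasure_density cong: nn_integral_cong intro!: prob_spaceI)

lemma prob_densityD:
  assumes "prob_density M g"
  shows "g \<in> borel_measurable M" "(\<integral>\<^sup>+x. g x \<partial>M) = 1" "AE x in M. g x < \<infinity>"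
  using assms AE_finite_of_nn_integral_le_1[of g M] by (auto simp: prob_density_def)

text \<open>The weight \<open>g\<close> cancels the denominator; mass of \<open>h\<close> where
  \<open>g\<close> is 0 or infinite is lost, hence only an inequality.\<close>

lemma nn_integral_density_ratio_le:
  fixes g h :: "'a \<Rightarrow> ennreal"
  assumes [measurable]: "g \<in> borel_measurable M" "h \<in> borel_measurable M"
  shows "(\<integral>\<^sup>+x. h x / g x \<partial>density M g) \<le> (\<integral>\<^sup>+x. h x \<partial>M)"
proof -
  have "(\<integral>\<^sup>+x. h x / g x \<partial>density M g) = (\<integral>\<^sup>+x. g x * (h x / g x) \<partial>M)"
    by (rule nn_integral_density) measurable
  also have "\<dots> \<le> (\<integral>\<^sup>+x. h x \<partial>M)"
    using mult_inverse_cancel_le_ennreal[of "h _" "g _"]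
    by (intro nn_integral_mono) (simp add: divide_ennreal_def mult_ac)
  finally show ?thesis .
qed

text \<open>This is \<open>log t \<le> t - 1\<close> at \<open>t = b / a\<close>.\<close>

lemma ln_ratio_ge:
  fixes a b :: ennreal
  assumes "0 < a" "a < \<infinity>" "0 < b" "b < \<infinity>"
  shows "0 \<le> ln (enn2real a / enn2real b) + (enn2real (b / a) - 1)"
proof -
  obtain a' b' where ab: "a = ennreal a'" "b = ennreal b'" "0 < a'" "0 < b'"
    using assms by (cases a; cases b) auto
  have "ln (b' / a') \<le> b' / a' - 1"
    using ab by (intro ln_le_minus_one) simp
  then show ?thesis
    using ab by (simp add: divide_ennreal ln_div)
qed

text \<open>Pointwise \<open>- log (g / h) \<le> h / g\<close>, and the right side integrates under
  \<open>g\<close> to at most the mass of \<open>h\<close>. So the negative part of a log-ratio is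
  always finite.\<close>

lemma nn_integral_neg_llr_le:
  assumes g: "prob_density M g"
    and h[measurable]: "h \<in> borel_measurable M" and h1: "(\<integral>\<^sup>+x. h x \<partial>M) \<le> 1"
    and pos: "AE x in M. 0 < g x \<longrightarrow> 0 < h x"
  shows "(\<integral>\<^sup>+x. ennreal (- llr g h x) \<partial>density M g) \<le> 1"
proof -
  note [measurable] = prob_densityD(1)[OF g]
  have "AE x in density M g. ennreal (- llr g h x) \<le> h x / g x"
  proof (subst AE_density, simp, use pos prob_densityD(3)[OF g] AE_finite_of_nn_integral_le_1[OF h h1] in eventually_elim, intro impI)
    fix x assume *: "0 < g x \<longrightarrow> 0 < h x" "g x < \<infinity>" "h x < \<infinity>" "0 < g x"
    then have "h x / g x \<noteq> \<infinity>" by (auto simp: ennreal_divide_eq_top_iff)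
    then have "ennreal (enn2real (h x / g x)) = h x / g x" by (simp add: less_top)
    moreover have "- llr g h x \<le> enn2real (h x / g x)"
      using ln_ratio_ge[of "g x" "h x"] * by (simp add: llr_def)
    ultimately show "ennreal (- llr g h x) \<le> h x / g x"
      by (metis ennreal_leI)
  qed
  then have "(\<integral>\<^sup>+x. ennreal (- llr g h x) \<partial>density M g) \<le> (\<integral>\<^sup>+x. h x / g x \<partial>density M g)"
    by (rule nn_integral_mono_AE)
  also have "\<dots> \<le> 1"
    using nn_integral_density_ratio_le[of g M h] h1 by (auto intro: order_trans)
  finally show ?thesis .
qed

text \<open>The factor \<open>a\<close> in \<open>kl_integrand\<close> moves into the measure;
  positivity of \<open>h\<close> rules out the value \<open>\<infinity>\<close>.\<close>

lemma kl_div_eq_nn_integral_llr: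
  assumes g: "prob_density M g" and h[measurable]: "h \<in> borel_measurable M"
    and pos: "AE x in M. 0 < g x \<longrightarrow> 0 < h x"
  shows "kl_div M g h =
    enn2ereal (\<integral>\<^sup>+x. ennreal (llr g h x) \<partial>density M g)
    - enn2ereal (\<integral>\<^sup>+x. ennreal (- llr g h x) \<partial>density M g)"
proof -
  note [measurable] = prob_densityD(1)[OF g]
  have 1: "AE x in M. e2ennreal (kl_integrand (g x) (h x)) = g x * ennreal (llr g h x) \<and>
      e2ennreal (- kl_integrand (g x) (h x)) = g x * ennreal (- llr g h x)"
    using pos prob_densityD(3)[OF g]
  proof eventually_elim
    fix x assume *: "0 < g x \<longrightarrow> 0 < h x" "g x < \<infinity>"
    obtain a where a: "g x = ennreal a" "a \<ge> 0" using *(2) by (cases "g x") auto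
    show "e2ennreal (kl_integrand (g x) (h x)) = g x * ennreal (llr g h x) \<and>
      e2ennreal (- kl_integrand (g x) (h x)) = g x * ennreal (- llr g h x)"
    proof (cases "a = 0")
      case True
      then show ?thesis using a by (simp add: kl_integrand_def e2ennreal_neg)
    next
      case False
      then have "a > 0" "h x \<noteq> 0" using * a by auto
      then show ?thesis
        using a by (simp add: kl_integrand_def llr_def ennreal_mult'[symmetric])
    qed
  qed
  show ?thesis
    unfolding kl_div_def
    using 1 by (subst (1 2) nn_integral_density) (auto intro!: arg_cong2[where f="(-)"] arg_cong[where f=enn2ereal] nn_integral_cong_AE)
qed

lemma kl_div_eq_integral_llr:
  assumes g: "prob_density M g" and h[measurable]: "h \<in> borel_measurable M"
    and pos: "AE x in M. 0 < g x \<longrightarrow> 0 < h x"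
    and int: "integrable (density M g) (llr g h)"
  shows "kl_div M g h = ereal (LINT x|density M g. llr g h x)"
proof -
  have "(\<integral>\<^sup>+x. ennreal (llr g h x) \<partial>density M g) < top" "(\<integral>\<^sup>+x. ennreal (- llr g h x) \<partial>density M g) < top"
    using int unfolding real_integrable_def by (auto simp: less_top)
  then show ?thesis
    unfolding kl_div_eq_nn_integral_llr[OF g h pos] real_lebesgue_integral_def[OF int]
    by (cases "\<integral>\<^sup>+x. ennreal (llr g h x) \<partial>density M g" rule: ennreal_cases;
        cases "\<integral>\<^sup>+x. ennreal (- llr g h x) \<partial>density M g" rule: ennreal_cases) auto
qed

text \<open>Since the negative part is bounded by the mass of \<open>h\<close>, a finite divergence
  forces a finite positive part, so the value \<open>\<infinity>\<close> at
  \<open>h x = 0 < g x\<close> occurs only on a null set.\<close>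

lemma kl_div_finiteD:
  assumes g: "prob_density M g"
    and h[measurable]: "h \<in> borel_measurable M" and h1: "(\<integral>\<^sup>+x. h x \<partial>M) \<le> 1"
    and fin: "kl_div M g h < \<infinity>"
  shows "AE x in M. 0 < g x \<longrightarrow> 0 < h x" "integrable (density M g) (llr g h)"
proof -
  note [measurable] = prob_densityD(1)[OF g]
  let ?p = "\<integral>\<^sup>+x. e2ennreal (kl_integrand (g x) (h x)) \<partial>M"
  let ?n = "\<integral>\<^sup>+x. e2ennreal (- kl_integrand (g x) (h x)) \<partial>M"
  have km[measurable]: "(\<lambda>x. kl_integrand (g x) (h x)) \<in> borel_measurable M"
    unfolding kl_integrand_def by measurable
  \<comment> \<open>The bound is proved for \<open>kl_integrand\<close> itself, because the
    \<open>llr\<close> form presupposes the positivity that is still to be derived.\<close>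
  have "?n \<le> (\<integral>\<^sup>+x. h x \<partial>M)"
  proof (rule nn_integral_mono_AE, use prob_densityD(3)[OF g] AE_finite_of_nn_integral_le_1[OF h h1] in eventually_elim)
    fix x assume *: "g x < \<infinity>" "h x < \<infinity>"
    show "e2ennreal (- kl_integrand (g x) (h x)) \<le> h x"
    proof (cases "g x = 0 \<or> h x = 0")
      case True
      then show ?thesis by (auto simp: kl_integrand_def e2ennreal_neg)
    next
      case False
      then obtain a b where ab: "g x = ennreal a" "h x = ennreal b" "0 < a" "0 < b"
        using * by (cases "g x"; cases "h x") auto
      have "- (a * ln (a / b)) \<le> b"
      proof -
        have "ln (b / a) \<le> b / a" using ab ln_le_minus_one[of "b/a"] by simp
        then have "a * ln (b / a) \<le> a * (b / a)"
          using ab by (intro mult_left_mono) auto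
        then show ?thesis using ab by (simp add: ln_div algebra_simps)
      qed
      then show ?thesis
        using ab by (simp add: kl_integrand_def ennreal_leI)
    qed
  qed
  then have "?n \<le> 1" using h1 by (rule order_trans)
  then have "?n \<noteq> \<infinity>" by (auto simp: top_unique)
  then have p: "?p \<noteq> \<infinity>"
    using fin unfolding kl_div_def by (cases ?n rule: ennreal_cases) auto
  have "AE x in M. e2ennreal (kl_integrand (g x) (h x)) \<noteq> \<infinity>"
    by (rule nn_integral_noteq_infinite[OF _ p]) measurable
  then show pos: "AE x in M. 0 < g x \<longrightarrow> 0 < h x"
    by eventually_elim (auto simp: kl_integrand_def zero_less_iff_neq_zero split: if_splits)
  have n: "(\<integral>\<^sup>+x. ennreal (- llr g h x) \<partial>density M g) \<le> 1"
    by (rule nn_integral_neg_llr_le[OF g h h1 pos])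
  then have n': "(\<integral>\<^sup>+x. ennreal (- llr g h x) \<partial>density M g) \<noteq> \<infinity>"
    by (auto simp: top_unique)
  have "(\<integral>\<^sup>+x. ennreal (llr g h x) \<partial>density M g) \<noteq> \<infinity>"
    using fin n' unfolding kl_div_eq_nn_integral_llr[OF g h pos]
    by (cases "\<integral>\<^sup>+x. ennreal (- llr g h x) \<partial>density M g" rule: ennreal_cases) auto
  with n' show "integrable (density M g) (llr g h)"
    unfolding real_integrable_def by simp
qed

text \<open>Gibbs' inequality: the excess bound compares the constant 0 with \<open>llr g h\<close>,
  taking \<open>u = h / g\<close>.\<close>

lemma kl_div_nonneg:
  assumes g: "prob_density M g"
    and h[measurable]: "h \<in> borel_measurable M" and h1: "(\<integral>\<^sup>+x. h x \<partial>M) \<le> 1"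
  shows "0 \<le> kl_div M g h"
proof (cases "kl_div M g h < \<infinity>")
  case True
  note [measurable] = prob_densityD(1)[OF g]
  note fin = kl_div_finiteD[OF g h h1 True]
  interpret prob_space "density M g" by (rule prob_space_density_of_prob_density[OF g])
  have "AE x in density M g. 0 \<le> llr g h x + (enn2real (h x / g x) - 1)"
    unfolding llr_def
    by (subst AE_density, simp, use fin(1) prob_densityD(3)[OF g] AE_finite_of_nn_integral_le_1[OF h h1] in eventually_elim)
      (use ln_ratio_ge in blast)
  moreover have "(\<integral>\<^sup>+x. h x / g x \<partial>density M g) \<le> 1"
    using nn_integral_density_ratio_le[of g M h] h1 by (auto intro: order_trans)
  ultimately have "expectation (\<lambda>x. 0) \<le> expectation (llr g h)"
    by (intro integral_le_of_excess(2)[OF fin(2), where u="\<lambda>x. h x / g x"]) auto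
  then show ?thesis
    using kl_div_eq_integral_llr[OF g h fin] by simp
qed auto

section \<open>Null sets of a factor lifted to the product\<close>

lemma (in pair_sigma_finite) AE_pair_fst:
  assumes "AE x in M1. P x"
  shows "AE z in M1 \<Otimes>\<^sub>M M2. P (fst z)"
proof -
  obtain A where A: "A \<in> null_sets M1" "{x \<in> space M1. \<not> P x} \<subseteq> A"
    using assms by (auto simp: eventually_ae_filter)
  then have "A \<times> space M2 \<in> null_sets (M1 \<Otimes>\<^sub>M M2)"
    by (auto simp: null_sets_def M2.emeasure_pair_measure_Times)
  then show ?thesis
    by (rule AE_I') (use A(2) in \<open>auto simp: space_pair_measure\<close>)
qed

lemma (in pair_sigma_finite) AE_pair_snd:
  assumes "AE y in M2. P y"
  shows "AE z in M1 \<Otimes>\<^sub>M M2. P (snd z)"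
proof -
  obtain A where A: "A \<in> null_sets M2" "{x \<in> space M2. \<not> P x} \<subseteq> A"
    using assms by (auto simp: eventually_ae_filter)
  then have "space M1 \<times> A \<in> null_sets (M1 \<Otimes>\<^sub>M M2)"
    by (auto simp: null_sets_def M2.emeasure_pair_measure_Times)
  then show ?thesis
    by (rule AE_I') (use A(2) in \<open>auto simp: space_pair_measure\<close>)
qed

section \<open>Mixtures, posteriors and the update\<close>

text \<open>General sigma-finite measures replace Lebesgue measure here. Pointwise finiteness of
  \<open>k\<close> lets the log identities be computed in the reals.\<close>

locale kernel_mixture = pair_sigma_finite M N
  for M :: "'a measure" and N :: "'b measure" +
  fixes k :: "'a \<Rightarrow> 'b \<Rightarrow> ennreal" and f :: "'a \<Rightarrow> ennreal"
  assumes k_measurable: "case_prod k \<in> borel_measurable (M \<Otimes>\<^sub>M N)"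
    and k_finite: "\<And>x \<theta>. x \<in> space M \<Longrightarrow> \<theta> \<in> space N \<Longrightarrow> k x \<theta> < \<infinity>"
    and k_prob_density: "\<And>\<theta>. \<theta> \<in> space N \<Longrightarrow> prob_density M (\<lambda>x. k x \<theta>)"
    and f_prob_density: "prob_density M f"
begin

abbreviation "mix \<equiv> mixture_dens N k"
abbreviation "post \<equiv> pi_star N k f"
abbreviation "joint q \<equiv> \<lambda>(x, \<theta>). q \<theta> * k x \<theta>"
abbreviation "post_measure q \<equiv> density (M \<Otimes>\<^sub>M N) (post q)"

definition ratio :: "('b \<Rightarrow> ennreal) \<Rightarrow> 'b \<Rightarrow> ennreal" where
  "ratio q \<theta> = (\<integral>\<^sup>+x. k x \<theta> * f x / mix q x \<partial>M)"

abbreviation "update q \<equiv> \<lambda>\<theta>. q \<theta> * ratio q \<theta>"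

text \<open>The invariant of the iteration: positivity of the mixture on \<open>{f > 0}\<close> is
  what makes the posterior a normalised density with first marginal \<open>f\<close>.\<close>

definition admissible :: "('b \<Rightarrow> ennreal) \<Rightarrow> bool" where
  "admissible q \<longleftrightarrow> prob_density N q \<and> (AE x in M. 0 < f x \<longrightarrow> 0 < mix q x)"

section \<open>Measurability and total masses\<close>

lemma f_measurable[measurable]: "f \<in> borel_measurable M"
  and nn_integral_f: "(\<integral>\<^sup>+x. f x \<partial>M) = 1"
  and AE_f_finite: "AE x in M. f x < \<infinity>"
  using prob_densityD[OF f_prob_density] by auto

lemma measurable_k[measurable (raw)]:
  assumes "g \<in> measurable L M" "h \<in> measurable L N"
  shows "(\<lambda>x. k (g x) (h x)) \<in> borel_measurable L"
  using measurable_compose[OF measurable_Pair[OF assms] k_measurable] by simp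

lemma measurable_mix[measurable]:
  assumes [measurable]: "q \<in> borel_measurable N"
  shows "mix q \<in> borel_measurable M"
  unfolding mixture_dens_def by measurable

lemma measurable_post[measurable]:
  assumes [measurable]: "q \<in> borel_measurable N"
  shows "post q \<in> borel_measurable (M \<Otimes>\<^sub>M N)"
  unfolding pi_star_def by measurable

lemma measurable_ratio[measurable]:
  assumes [measurable]: "q \<in> borel_measurable N"
  shows "ratio q \<in> borel_measurable N"
  unfolding ratio_def by measurable

lemma nn_integral_joint:
  assumes [measurable]: "q \<in> borel_measurable N"
  shows "(\<integral>\<^sup>+z. joint q z \<partial>(M \<Otimes>\<^sub>M N)) = (\<integral>\<^sup>+\<theta>. q \<theta> \<partial>N)"
proof -
  have "(\<integral>\<^sup>+z. joint q z \<partial>(M \<Otimes>\<^sub>M N)) = (\<integral>\<^sup>+\<theta>. \<integral>\<^sup>+x. q \<theta> * k x \<theta> \<partial>M \<partial>N)"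
    by (subst nn_integral_snd[symmetric]) auto
  also have "\<dots> = (\<integral>\<^sup>+\<theta>. q \<theta> \<partial>N)"
    using prob_densityD(2)[OF k_prob_density]
    by (intro nn_integral_cong) (simp add: nn_integral_cmult)
  finally show ?thesis .
qed

lemma nn_integral_mix:
  assumes [measurable]: "q \<in> borel_measurable N"
  shows "(\<integral>\<^sup>+x. mix q x \<partial>M) = (\<integral>\<^sup>+\<theta>. q \<theta> \<partial>N)"
proof -
  have "(\<integral>\<^sup>+z. joint q z \<partial>(M \<Otimes>\<^sub>M N)) = (\<integral>\<^sup>+x. mix q x \<partial>M)"
    by (subst M2.nn_integral_fst[symmetric])
      (auto simp: mixture_dens_def[abs_def] mult.commute)
  then show ?thesis
    by (simp add: nn_integral_joint)
qed

lemma AE_mix_finite: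
  assumes "prob_density N q"
  shows "AE x in M. mix q x < \<infinity>"
  using prob_densityD[OF assms] by (intro AE_finite_of_nn_integral_le_1) (auto simp: nn_integral_mix)

text \<open>Integrating out \<open>\<theta>\<close> by Tonelli turns the numerator into
  \<open>mix q x\<close>. The quotient is left uncancelled because it is 0, not 1, where
  \<open>mix q x\<close> is 0 or infinite.\<close>

lemma nn_integral_mult_post:
  assumes [measurable]: "q \<in> borel_measurable N" "h \<in> borel_measurable M"
  shows "(\<integral>\<^sup>+z. post q z * h (fst z) \<partial>(M \<Otimes>\<^sub>M N)) = (\<integral>\<^sup>+x. f x * h x * (mix q x * inverse (mix q x)) \<partial>M)"
proof -
  have "(\<integral>\<^sup>+z. post q z * h (fst z) \<partial>(M \<Otimes>\<^sub>M N)) = (\<integral>\<^sup>+x. \<integral>\<^sup>+\<theta>. (f x * h x * inverse (mix q x)) * (k x \<theta> * q \<theta>) \<partial>N \<partial>M)"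
    by (subst M2.nn_integral_fst[symmetric]) (auto simp: pi_star_def divide_ennreal_def mult_ac)
  also have "\<dots> = (\<integral>\<^sup>+x. f x * h x * (mix q x * inverse (mix q x)) \<partial>M)"
  proof (intro nn_integral_cong)
    fix x assume [simp]: "x \<in> space M"
    show "(\<integral>\<^sup>+\<theta>. (f x * h x * inverse (mix q x)) * (k x \<theta> * q \<theta>) \<partial>N) =
        f x * h x * (mix q x * inverse (mix q x))"
      by (subst nn_integral_cmult) (simp_all add: mixture_dens_def mult_ac)
  qed
  finally show ?thesis .
qed

lemma nn_integral_post_le_1:
  assumes [measurable]: "q \<in> borel_measurable N"
  shows "(\<integral>\<^sup>+z. post q z \<partial>(M \<Otimes>\<^sub>M N)) \<le> 1"
proof -
  have "(\<integral>\<^sup>+z. post q z \<partial>(M \<Otimes>\<^sub>M N)) = (\<integral>\<^sup>+x. f x * (mix q x * inverse (mix q x)) \<partial>M)"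
    using nn_integral_mult_post[of q "\<lambda>_. 1"] by simp
  also have "\<dots> \<le> (\<integral>\<^sup>+x. f x \<partial>M)"
    by (intro nn_integral_mono mult_inverse_cancel_le_ennreal)
  finally show ?thesis by (simp add: nn_integral_f)
qed

section \<open>First marginal of the posterior\<close>

lemma admissibleD:
  assumes "admissible q"
  shows "prob_density N q" "q \<in> borel_measurable N" "(\<integral>\<^sup>+\<theta>. q \<theta> \<partial>N) = 1" "AE \<theta> in N. q \<theta> < \<infinity>"
    "AE x in M. 0 < f x \<longrightarrow> 0 < mix q x" "AE x in M. mix q x < \<infinity>"
  using assms prob_densityD[of N q] AE_mix_finite[of q] by (auto simp: admissible_def)

lemma nn_integral_post_measure_fst:
  assumes q: "admissible q" and [measurable]: "h \<in> borel_measurable M"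
  shows "(\<integral>\<^sup>+z. h (fst z) \<partial>post_measure q) = (\<integral>\<^sup>+x. h x \<partial>density M f)"
proof -
  note [measurable] = admissibleD(2)[OF q]
  have "(\<integral>\<^sup>+z. h (fst z) \<partial>post_measure q) = (\<integral>\<^sup>+x. f x * h x * (mix q x * inverse (mix q x)) \<partial>M)"
    by (simp add: nn_integral_density nn_integral_mult_post)
  also have "\<dots> = (\<integral>\<^sup>+x. f x * h x \<partial>M)"
  proof (rule nn_integral_cong_AE, use admissibleD(5,6)[OF q] in eventually_elim)
    fix x assume *: "0 < f x \<longrightarrow> 0 < mix q x" "mix q x < \<infinity>"
    show "f x * h x * (mix q x * inverse (mix q x)) = f x * h x"
    proof (cases "f x = 0")
      case False
      then have "mix q x * inverse (mix q x) = 1"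
        using * ennreal_divide_self[of "mix q x"] by (auto simp: divide_ennreal_def zero_less_iff_neq_zero)
      then show ?thesis by simp
    qed simp
  qed
  finally show ?thesis
    by (simp add: nn_integral_density)
qed

lemma prob_density_post:
  assumes q: "admissible q"
  shows "prob_density (M \<Otimes>\<^sub>M N) (post q)"
proof -
  note [measurable] = admissibleD(2)[OF q]
  have "(\<integral>\<^sup>+z. post q z \<partial>(M \<Otimes>\<^sub>M N)) = 1"
    using nn_integral_post_measure_fst[OF q, of "\<lambda>_. 1"] nn_integral_f
    by (simp add: nn_integral_density del: nn_integral_const)
  then show ?thesis by (simp add: prob_density_def)
qed

text \<open>Stated as an equality of measures so that integrability and Bochner integrals of
  functions of \<open>x\<close> can be transferred, not only nonnegative integrals.\<close>

lemma distr_post_measure: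
  assumes q: "admissible q"
  shows "distr (post_measure q) M fst = density M f"
proof (rule measure_eqI)
  fix A assume "A \<in> sets (distr (post_measure q) M fst)"
  then have A[measurable]: "A \<in> sets M" by simp
  have "emeasure (distr (post_measure q) M fst) A = (\<integral>\<^sup>+z. indicator A (fst z) \<partial>post_measure q)"
    by (subst nn_integral_distr[of fst _ M "indicator A", symmetric]) auto
  also have "\<dots> = emeasure (density M f) A"
    by (subst nn_integral_post_measure_fst[OF q]) auto
  finally show "emeasure (distr (post_measure q) M fst) A = emeasure (density M f) A" .
qed simp

lemma integrable_post_measure_fst:
  fixes L :: "'a \<Rightarrow> real"
  assumes q: "admissible q" and [measurable]: "L \<in> borel_measurable M"
  shows "integrable (post_measure q) (\<lambda>z. L (fst z)) \<longleftrightarrow> integrable (density M f) L"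
    and "(LINT z|post_measure q. L (fst z)) = (LINT x|density M f. L x)"
  using integrable_distr_eq[of fst "post_measure q" M L] integral_distr[of fst "post_measure q" M L]
  by (auto simp: distr_post_measure[OF q])

section \<open>Positivity and normalisation of the update\<close>

text \<open>Under the posterior the update never kills mass: this keeps the mixtures positive, hence
  the iterates normalised.\<close>

lemma AE_ratio_pos:
  assumes q: "prob_density N q"
  shows "AE z in M \<Otimes>\<^sub>M N. 0 < k (fst z) (snd z) * f (fst z) \<longrightarrow> 0 < ratio q (snd z)"
proof -
  note [measurable] = prob_densityD(1)[OF q]
  have "AE x in M. 0 < k x \<theta> * f x \<longrightarrow> 0 < ratio q \<theta>" if [simp]: "\<theta> \<in> space N" for \<theta>
  proof (cases "ratio q \<theta> = 0")
    case True
    then have "AE x in M. k x \<theta> * f x / mix q x = 0"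
      unfolding ratio_def by (subst (asm) nn_integral_0_iff_AE) auto
    \<comment> \<open>Finiteness of the denominator matters: a quotient by \<open>top\<close> would
      vanish without its numerator being 0.\<close>
    with AE_mix_finite[OF q] show ?thesis
      by eventually_elim (auto simp: ennreal_divide_eq_0_iff)
  qed (auto simp: zero_less_iff_neq_zero)
  then have "AE \<theta> in N. AE x in M. 0 < k x \<theta> * f x \<longrightarrow> 0 < ratio q \<theta>"
    by (auto intro!: AE_I2)
  then have "AE x in M. AE \<theta> in N. 0 < k x \<theta> * f x \<longrightarrow> 0 < ratio q \<theta>"
    by (subst AE_commute) auto
  then show ?thesis
    by (intro AE_pair_measure) auto
qed

text \<open>By Tonelli, \<open>update q\<close> is the second marginal of \<open>post q\<close>, so
  it inherits the posterior's mass 1.\<close>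

lemma nn_integral_update:
  assumes q: "admissible q"
  shows "(\<integral>\<^sup>+\<theta>. update q \<theta> \<partial>N) = 1"
proof -
  note [measurable] = admissibleD(2)[OF q]
  have "(\<integral>\<^sup>+z. post q z \<partial>(M \<Otimes>\<^sub>M N)) = (\<integral>\<^sup>+\<theta>. \<integral>\<^sup>+x. q \<theta> * (k x \<theta> * f x / mix q x) \<partial>M \<partial>N)"
    by (subst nn_integral_snd[symmetric]) (auto simp: pi_star_def divide_ennreal_def mult_ac)
  also have "\<dots> = (\<integral>\<^sup>+\<theta>. update q \<theta> \<partial>N)"
    unfolding ratio_def by (intro nn_integral_cong) (simp add: nn_integral_cmult)
  finally show ?thesis
    using prob_densityD(2)[OF prob_density_post[OF q]] by simp
qed

lemma AE_ratio_finite: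
  assumes q: "admissible q"
  shows "AE \<theta> in N. 0 < q \<theta> \<longrightarrow> ratio q \<theta> < \<infinity>"
proof -
  note [measurable] = admissibleD(2)[OF q]
  have "AE \<theta> in N. update q \<theta> < \<infinity>"
    by (rule AE_finite_of_nn_integral_le_1) (simp_all add: nn_integral_update[OF q])
  then show ?thesis
    by eventually_elim (auto simp: ennreal_mult_less_top less_top)
qed

text \<open>If the new mixture vanished at \<open>x\<close> with \<open>f x > 0\<close>, then
  \<open>k x \<theta> * update q \<theta>\<close> would vanish for almost all
  \<open>\<theta>\<close>. As \<open>ratio q\<close> is positive wherever
  \<open>k x \<theta>\<close> is, up to null sets, the old mixture would vanish too.\<close>

lemma admissible_update:
  assumes q: "admissible q"
  shows "admissible (update q)"
proof -
  note [measurable] = admissibleD(2)[OF q]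
  have "AE z in M \<Otimes>\<^sub>M N. 0 < f (fst z) \<longrightarrow> 0 < k (fst z) (snd z) * q (snd z) \<longrightarrow>
      0 < k (fst z) (snd z) * update q (snd z)"
    using AE_ratio_pos[OF admissibleD(1)[OF q]]
    by eventually_elim (auto simp: ennreal_zero_less_mult_iff)
  then have "AE x in M. AE \<theta> in N. 0 < f x \<longrightarrow> 0 < k x \<theta> * q \<theta> \<longrightarrow> 0 < k x \<theta> * update q \<theta>"
    by (auto dest: AE_pair)
  with admissibleD(5)[OF q] AE_space
  have "AE x in M. 0 < f x \<longrightarrow> 0 < mix (update q) x"
  proof eventually_elim
    case (elim x)
    note [simp] = elim(2)
    show ?case
    proof (intro impI, rule ccontr)
      assume fx: "0 < f x" and "\<not> 0 < mix (update q) x"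
      then have "(\<integral>\<^sup>+\<theta>. k x \<theta> * update q \<theta> \<partial>N) = 0"
        by (simp add: mixture_dens_def)
      then have "AE \<theta> in N. k x \<theta> * update q \<theta> = 0"
        by (subst (asm) nn_integral_0_iff_AE) auto
      with elim(3) have "AE \<theta> in N. k x \<theta> * q \<theta> = 0"
        by eventually_elim (use fx in \<open>auto simp: zero_less_iff_neq_zero\<close>)
      then have "mix q x = 0"
        unfolding mixture_dens_def by (subst nn_integral_0_iff_AE) auto
      then show False using elim(1) fx by simp
    qed
  qed
  then show ?thesis
    by (simp add: admissible_def prob_density_def nn_integral_update[OF q])
qed

lemma AE_post_pos:
  assumes p: "admissible p"
  shows "AE z in M \<Otimes>\<^sub>M N. 0 < post p z \<longrightarrow>
     0 < f (fst z) \<and> f (fst z) < \<infinity> \<and> 0 < p (snd z) \<and> p (snd z) < \<infinity> \<and>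
     0 < k (fst z) (snd z) \<and> k (fst z) (snd z) < \<infinity> \<and> 0 < mix p (fst z) \<and> mix p (fst z) < \<infinity>"
  using AE_pair_fst[OF AE_f_finite] AE_pair_snd[OF admissibleD(4)[OF p]]
    AE_pair_fst[OF admissibleD(5)[OF p]] AE_pair_fst[OF admissibleD(6)[OF p]] AE_space
proof eventually_elim
  case (elim z)
  then show ?case
    using k_finite[of "fst z" "snd z"]
    by (cases z) (auto simp: pi_star_def ennreal_zero_less_divide ennreal_zero_less_mult_iff space_pair_measure)
qed

end

section \<open>Divergence inequalities\<close>

lemma ennreal_pos_finiteE:
  fixes x :: ennreal
  assumes "0 < x" "x < \<infinity>"
  obtains r where "0 < r" "x = ennreal r"
  using assms by (cases x) auto

text \<open>Here \<open>F / b\<close> is the joint ratio times \<open>u\<close>, where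
  \<open>u\<close> is the quotient of the two posteriors; then
  \<open>log u \<le> u - 1\<close>.\<close>

lemma log_ratio_marginal_le:
  fixes F k p q a b :: ennreal
  assumes "0 < F" "F < \<infinity>" "0 < k" "k < \<infinity>" "0 < p" "p < \<infinity>" "0 < q" "q < \<infinity>"
    "0 < a" "a < \<infinity>" "0 < b" "b < \<infinity>"
  shows "ln (enn2real F / enn2real b) \<le> ln (enn2real (F * p * k / a) / enn2real (q * k))
    + (enn2real ((F * q * k / b) / (F * p * k / a)) - 1)"
proof -
  obtain F' where F': "0 < F'" "F = ennreal F'"
    using assms(1,2) by (rule ennreal_pos_finiteE)
  obtain k' where k': "0 < k'" "k = ennreal k'"
    using assms(3,4) by (rule ennreal_pos_finiteE)
  obtain p' where p': "0 < p'" "p = ennreal p'"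
    using assms(5,6) by (rule ennreal_pos_finiteE)
  obtain q' where q': "0 < q'" "q = ennreal q'"
    using assms(7,8) by (rule ennreal_pos_finiteE)
  obtain a' where a': "0 < a'" "a = ennreal a'"
    using assms(9,10) by (rule ennreal_pos_finiteE)
  obtain b' where b': "0 < b'" "b = ennreal b'"
    using assms(11,12) by (rule ennreal_pos_finiteE)
  note e = F'(2) k'(2) p'(2) q'(2) a'(2) b'(2) and pos = F'(1) k'(1) p'(1) q'(1) a'(1) b'(1)
  have "ln ((F' * q' * k' / b') / (F' * p' * k' / a')) \<le> (F' * q' * k' / b') / (F' * p' * k' / a') - 1"
    using pos by (intro ln_le_minus_one) simp
  then show ?thesis
    using pos by (simp add: e ennreal_mult[symmetric] divide_ennreal ln_div ln_mult)
qed

text \<open>With \<open>u = a / (b r)\<close>, the left ratio equals the old joint ratio times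
  \<open>(F / a) / (F / b)\<close> times \<open>u\<close>, because these last two factors multiply
  to \<open>1 / r\<close>.\<close>

lemma log_ratio_update_le:
  fixes F k p q a b r :: ennreal
  assumes "0 < F" "F < \<infinity>" "0 < k" "k < \<infinity>" "0 < p" "p < \<infinity>" "0 < q" "q < \<infinity>"
    "0 < a" "a < \<infinity>" "0 < b" "b < \<infinity>" "0 < r" "r < \<infinity>"
  shows "ln (enn2real (F * p * k / a) / enn2real (q * r * k))
    \<le> ln (enn2real (F * p * k / a) / enn2real (q * k)) + ln (enn2real F / enn2real a)
      - ln (enn2real F / enn2real b) + (enn2real (a * inverse b * inverse r) - 1)"
proof -
  obtain F' where F': "0 < F'" "F = ennreal F'"
    using assms(1,2) by (rule ennreal_pos_finiteE)
  obtain k' where k': "0 < k'" "k = ennreal k'"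
    using assms(3,4) by (rule ennreal_pos_finiteE)
  obtain p' where p': "0 < p'" "p = ennreal p'"
    using assms(5,6) by (rule ennreal_pos_finiteE)
  obtain q' where q': "0 < q'" "q = ennreal q'"
    using assms(7,8) by (rule ennreal_pos_finiteE)
  obtain a' where a': "0 < a'" "a = ennreal a'"
    using assms(9,10) by (rule ennreal_pos_finiteE)
  obtain b' where b': "0 < b'" "b = ennreal b'"
    using assms(11,12) by (rule ennreal_pos_finiteE)
  obtain r' where r': "0 < r'" "r = ennreal r'"
    using assms(13,14) by (rule ennreal_pos_finiteE)
  note e = F'(2) k'(2) p'(2) q'(2) a'(2) b'(2) r'(2) and pos = F'(1) k'(1) p'(1) q'(1) a'(1) b'(1) r'(1)
  have "ln (a' * inverse b' * inverse r') \<le> a' * inverse b' * inverse r' - 1"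
    using pos by (intro ln_le_minus_one) simp
  then show ?thesis
    using pos by (simp add: e ennreal_mult[symmetric] divide_ennreal inverse_ennreal ln_div ln_mult ln_inverse)
qed

section \<open>Comparison of divergences under the posterior measure\<close>

context kernel_mixture
begin

lemma kl_div_post_joint_finiteD:
  assumes p: "admissible p" and q: "admissible q"
    and fin: "kl_div (M \<Otimes>\<^sub>M N) (post p) (joint q) < \<infinity>"
  shows "AE z in M \<Otimes>\<^sub>M N. 0 < post p z \<longrightarrow> 0 < joint q z"
    and "integrable (post_measure p) (llr (post p) (joint q))"
    and "kl_div (M \<Otimes>\<^sub>M N) (post p) (joint q) = ereal (LINT z|post_measure p. llr (post p) (joint q) z)"
proof -
  note [measurable] = admissibleD(2)[OF p] admissibleD(2)[OF q]
  have 1: "(\<integral>\<^sup>+z. joint q z \<partial>(M \<Otimes>\<^sub>M N)) \<le> 1"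
    using nn_integral_joint[of q] admissibleD(3)[OF q] by simp
  show 2: "AE z in M \<Otimes>\<^sub>M N. 0 < post p z \<longrightarrow> 0 < joint q z"
    and 3: "integrable (post_measure p) (llr (post p) (joint q))"
    using kl_div_finiteD[OF prob_density_post[OF p] _ 1 fin] by auto
  show "kl_div (M \<Otimes>\<^sub>M N) (post p) (joint q) = ereal (LINT z|post_measure p. llr (post p) (joint q) z)"
    using kl_div_eq_integral_llr[OF prob_density_post[OF p] _ 2 3] by simp
qed

text \<open>The divergence on the first factor is rewritten over the joint posterior, so that all
  log-ratios live on one probability space. The posterior may come from any admissible
  \<open>p\<close>, since its first marginal is always \<open>f\<close>.\<close>

lemma kl_div_mix_finiteD:
  assumes p: "admissible p" and q: "admissible q" and fin: "kl_div M f (mix q) < \<infinity>"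
  shows "integrable (post_measure p) (\<lambda>z. llr f (mix q) (fst z))"
    and "kl_div M f (mix q) = ereal (LINT z|post_measure p. llr f (mix q) (fst z))"
proof -
  note [measurable] = admissibleD(2)[OF p] admissibleD(2)[OF q]
  have 1: "(\<integral>\<^sup>+x. mix q x \<partial>M) \<le> 1"
    using nn_integral_mix[of q] admissibleD(3)[OF q] by simp
  have i: "integrable (density M f) (llr f (mix q))"
    using kl_div_finiteD[OF f_prob_density _ 1 fin] by auto
  then show "integrable (post_measure p) (\<lambda>z. llr f (mix q) (fst z))"
    by (simp add: integrable_post_measure_fst[OF p])
  show "kl_div M f (mix q) = ereal (LINT z|post_measure p. llr f (mix q) (fst z))"
    using kl_div_eq_integral_llr[OF f_prob_density _ admissibleD(5)[OF q] i]
    by (simp add: integrable_post_measure_fst[OF p])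
qed

text \<open>Passing to first marginals cannot increase divergence: \<open>f\<close> and
  \<open>mix q\<close> are the marginals of \<open>post p\<close> and
  \<open>joint q\<close>.\<close>

lemma kl_div_mix_le_kl_div_post:
  assumes p: "admissible p" and q: "admissible q"
  shows "kl_div M f (mix q) \<le> kl_div (M \<Otimes>\<^sub>M N) (post p) (joint q)"
proof (cases "kl_div (M \<Otimes>\<^sub>M N) (post p) (joint q) < \<infinity>")
  case True
  note [measurable] = admissibleD(2)[OF p] admissibleD(2)[OF q]
  note fin = kl_div_post_joint_finiteD[OF p q True]
  interpret Q: prob_space "post_measure p"
    by (rule prob_space_density_of_prob_density[OF prob_density_post[OF p]])
  let ?A = "\<lambda>z. llr f (mix q) (fst z)" and ?u = "\<lambda>z. post q z / post p z"
  have "(\<integral>\<^sup>+z. ?u z \<partial>post_measure p) \<le> 1"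
    using nn_integral_density_ratio_le[of "post p" "M \<Otimes>\<^sub>M N" "post q"] nn_integral_post_le_1[of q]
    by (auto intro: order_trans)
  \<comment> \<open>\<open>?A\<close> depends on \<open>x\<close> only, so its negative part can be
    bounded under \<open>density M f\<close>.\<close>
  moreover have "(\<integral>\<^sup>+z. ennreal (- ?A z) \<partial>post_measure p) < \<infinity>"
  proof -
    have "(\<integral>\<^sup>+z. ennreal (- ?A z) \<partial>post_measure p) = (\<integral>\<^sup>+x. ennreal (- llr f (mix q) x) \<partial>density M f)"
      by (rule nn_integral_post_measure_fst[OF p]) measurable
    also have "\<dots> \<le> 1"
      using admissibleD(3)[OF q]
      by (intro nn_integral_neg_llr_le[OF f_prob_density _ _ admissibleD(5)[OF q]]) (auto simp: nn_integral_mix)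
    finally show ?thesis by (auto intro: le_less_trans)
  qed
  moreover have "AE z in post_measure p. ?A z \<le> llr (post p) (joint q) z + (enn2real (?u z) - 1)"
  proof (subst AE_density, simp, use AE_post_pos[OF p] fin(1) AE_pair_snd[OF admissibleD(4)[OF q]]
      AE_pair_fst[OF admissibleD(5)[OF q]] AE_pair_fst[OF admissibleD(6)[OF q]] in eventually_elim)
    case (elim z)
    then show ?case
      using log_ratio_marginal_le[of "f (fst z)" "k (fst z) (snd z)" "p (snd z)" "q (snd z)" "mix p (fst z)" "mix q (fst z)"]
      by (cases z) (auto simp: llr_def pi_star_def ennreal_zero_less_mult_iff)
  qed
  ultimately have "integrable (post_measure p) ?A"
      and le: "Q.expectation ?A \<le> Q.expectation (llr (post p) (joint q))"
    using Q.integral_le_of_excess[OF fin(2), of ?A ?u] by auto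
  then have "integrable (density M f) (llr f (mix q))"
    by (simp add: integrable_post_measure_fst[OF p])
  then have "kl_div M f (mix q) = ereal (Q.expectation ?A)"
    using kl_div_eq_integral_llr[OF f_prob_density _ admissibleD(5)[OF q]]
    by (simp add: integrable_post_measure_fst[OF p])
  then show ?thesis
    using le fin(3) by simp
qed auto

text \<open>The equality case of the marginal bound: \<open>post p / joint p\<close> reduces to
  \<open>f / mix p\<close>.\<close>

lemma kl_div_post_self:
  assumes p: "admissible p" and fin: "kl_div M f (mix p) < \<infinity>"
  shows "kl_div (M \<Otimes>\<^sub>M N) (post p) (joint p) = kl_div M f (mix p)"
proof -
  note [measurable] = admissibleD(2)[OF p]
  have eq: "AE z in M \<Otimes>\<^sub>M N. 0 < post p z \<longrightarrow> 0 < joint p z \<and> llr f (mix p) (fst z) = llr (post p) (joint p) z"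
    using AE_post_pos[OF p]
  proof eventually_elim
    case (elim z)
    obtain x \<theta> where z: "z = (x, \<theta>)" by (cases z)
    show ?case
    proof
      assume "0 < post p z"
      with elim z have *: "0 < f x" "f x < \<infinity>" "0 < k x \<theta>" "k x \<theta> < \<infinity>" "0 < p \<theta>" "p \<theta> < \<infinity>"
          "0 < mix p x" "mix p x < \<infinity>"
        by auto
      obtain F where F: "0 < F" "f x = ennreal F"
        using *(1,2) by (rule ennreal_pos_finiteE)
      obtain k' where k': "0 < k'" "k x \<theta> = ennreal k'"
        using *(3,4) by (rule ennreal_pos_finiteE)
      obtain p' where p': "0 < p'" "p \<theta> = ennreal p'"
        using *(5,6) by (rule ennreal_pos_finiteE)
      obtain a where a: "0 < a" "mix p x = ennreal a"
        using *(7,8) by (rule ennreal_pos_finiteE)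
      show "0 < joint p z \<and> llr f (mix p) (fst z) = llr (post p) (joint p) z"
        using F k' p' a by (simp add: z llr_def pi_star_def ennreal_mult[symmetric] divide_ennreal)
    qed
  qed
  then have eq': "AE z in post_measure p. llr f (mix p) (fst z) = llr (post p) (joint p) z"
    by (subst AE_density) auto
  note fin' = kl_div_mix_finiteD[OF p p fin]
  have "integrable (post_measure p) (llr (post p) (joint p))"
    by (rule integrable_cong_AE_imp[OF fin'(1)]) (use eq' in \<open>auto elim: eventually_mono\<close>)
  moreover have "(LINT z|post_measure p. llr f (mix p) (fst z)) = (LINT z|post_measure p. llr (post p) (joint p) z)"
    using eq' by (intro integral_cong_AE) auto
  moreover have "AE z in M \<Otimes>\<^sub>M N. 0 < post p z \<longrightarrow> 0 < joint p z"
    using eq by eventually_elim auto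
  ultimately show ?thesis
    using kl_div_eq_integral_llr[OF prob_density_post[OF p], of "joint p"] fin'(2) by simp
qed

text \<open>The factor \<open>mix p\<close> cancels the posterior's denominator. Integrating the
  rest over \<open>x\<close> produces \<open>ratio q\<close>, which cancels its inverse and leaves
  at most the mass of \<open>p\<close>.\<close>

lemma nn_integral_update_excess_le_1:
  assumes p: "admissible p" and q: "admissible q"
  shows "(\<integral>\<^sup>+z. mix p (fst z) * inverse (mix q (fst z)) * inverse (ratio q (snd z)) \<partial>post_measure p) \<le> 1"
proof -
  note [measurable] = admissibleD(2)[OF p] admissibleD(2)[OF q]
  let ?u = "\<lambda>z. mix p (fst z) * inverse (mix q (fst z)) * inverse (ratio q (snd z))"
  have "(\<integral>\<^sup>+z. ?u z \<partial>post_measure p) = (\<integral>\<^sup>+z. post p z * ?u z \<partial>(M \<Otimes>\<^sub>M N))"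
    by (rule nn_integral_density) measurable
  also have "\<dots> \<le> (\<integral>\<^sup>+z. p (snd z) * inverse (ratio q (snd z)) * (k (fst z) (snd z) * f (fst z) / mix q (fst z)) \<partial>(M \<Otimes>\<^sub>M N))"
  proof (rule nn_integral_mono)
    fix z :: "'a \<times> 'b"
    have "post p z * ?u z = p (snd z) * inverse (ratio q (snd z)) * (k (fst z) (snd z) * f (fst z) / mix q (fst z))
      * (mix p (fst z) * inverse (mix p (fst z)))"
      by (cases z) (simp add: pi_star_def divide_ennreal_def mult_ac)
    also have "\<dots> \<le> p (snd z) * inverse (ratio q (snd z)) * (k (fst z) (snd z) * f (fst z) / mix q (fst z))"
      by (rule mult_inverse_cancel_le_ennreal)
    finally show "post p z * ?u z \<le> p (snd z) * inverse (ratio q (snd z)) * (k (fst z) (snd z) * f (fst z) / mix q (fst z))" .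
  qed
  also have "\<dots> = (\<integral>\<^sup>+\<theta>. \<integral>\<^sup>+x. p \<theta> * inverse (ratio q \<theta>) * (k x \<theta> * f x / mix q x) \<partial>M \<partial>N)"
    by (subst nn_integral_snd[symmetric]) auto
  also have "\<dots> = (\<integral>\<^sup>+\<theta>. p \<theta> * (ratio q \<theta> * inverse (ratio q \<theta>)) \<partial>N)"
  proof (intro nn_integral_cong)
    fix \<theta> assume [simp]: "\<theta> \<in> space N"
    show "(\<integral>\<^sup>+x. p \<theta> * inverse (ratio q \<theta>) * (k x \<theta> * f x / mix q x) \<partial>M) = p \<theta> * (ratio q \<theta> * inverse (ratio q \<theta>))"
      by (subst nn_integral_cmult) (simp_all add: ratio_def mult.assoc mult.commute[of "inverse _"])
  qed
  also have "\<dots> \<le> (\<integral>\<^sup>+\<theta>. p \<theta> \<partial>N)"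
    by (intro nn_integral_mono mult_inverse_cancel_le_ennreal)
  finally show ?thesis
    using admissibleD(3)[OF p] by simp
qed

lemma kl_div_post_update_le:
  assumes p: "admissible p" and q: "admissible q"
    and fin: "kl_div (M \<Otimes>\<^sub>M N) (post p) (joint q) < \<infinity>" and finp: "kl_div M f (mix p) < \<infinity>"
  shows "kl_div (M \<Otimes>\<^sub>M N) (post p) (joint (update q)) + kl_div M f (mix q)
    \<le> kl_div (M \<Otimes>\<^sub>M N) (post p) (joint q) + kl_div M f (mix p)"
proof -
  note [measurable] = admissibleD(2)[OF p] admissibleD(2)[OF q]
  note q' = admissible_update[OF q]
  note J = kl_div_post_joint_finiteD[OF p q fin]
  \<comment> \<open>This makes the subtracted log-ratio in \<open>?B\<close> integrable.\<close>
  have finq: "kl_div M f (mix q) < \<infinity>"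
    using kl_div_mix_le_kl_div_post[OF p q] fin by (rule le_less_trans)
  note F = kl_div_mix_finiteD[OF p p finp] and G = kl_div_mix_finiteD[OF p q finq]
  interpret Q: prob_space "post_measure p"
    by (rule prob_space_density_of_prob_density[OF prob_density_post[OF p]])
  let ?A = "llr (post p) (joint (update q))"
  let ?B = "\<lambda>z. llr (post p) (joint q) z + llr f (mix p) (fst z) - llr f (mix q) (fst z)"
  let ?u = "\<lambda>z. mix p (fst z) * inverse (mix q (fst z)) * inverse (ratio q (snd z))"
  have pos: "AE z in M \<Otimes>\<^sub>M N. 0 < post p z \<longrightarrow> 0 < joint (update q) z"
    using J(1) AE_post_pos[OF p] AE_ratio_pos[OF admissibleD(1)[OF q]]
    by eventually_elim (auto simp: ennreal_zero_less_mult_iff split: prod.splits)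
  have B: "integrable (post_measure p) ?B"
    using J(2) F(1) G(1) by simp
  have "(\<integral>\<^sup>+z. ennreal (- ?A z) \<partial>post_measure p) \<le> 1"
    using nn_integral_joint[of "update q"] admissibleD(3)[OF q']
    by (intro nn_integral_neg_llr_le[OF prob_density_post[OF p] _ _ pos]) auto
  then have "(\<integral>\<^sup>+z. ennreal (- ?A z) \<partial>post_measure p) < \<infinity>"
    by (auto intro: le_less_trans)
  moreover have "AE z in post_measure p. ?A z \<le> ?B z + (enn2real (?u z) - 1)"
  proof (subst AE_density, simp, use AE_post_pos[OF p] J(1) AE_pair_snd[OF admissibleD(4)[OF q]]
      AE_pair_fst[OF admissibleD(5)[OF q]] AE_pair_fst[OF admissibleD(6)[OF q]]
      AE_ratio_pos[OF admissibleD(1)[OF q]] AE_pair_snd[OF AE_ratio_finite[OF q]] in eventually_elim)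
    case (elim z)
    then show ?case
      using log_ratio_update_le[of "f (fst z)" "k (fst z) (snd z)" "p (snd z)" "q (snd z)" "mix p (fst z)" "mix q (fst z)" "ratio q (snd z)"]
      by (cases z) (auto simp: llr_def pi_star_def ennreal_zero_less_mult_iff)
  qed
  ultimately have A: "integrable (post_measure p) ?A" and le: "Q.expectation ?A \<le> Q.expectation ?B"
    using Q.integral_le_of_excess[OF B, of ?A ?u] nn_integral_update_excess_le_1[OF p q] by auto
  have "kl_div (M \<Otimes>\<^sub>M N) (post p) (joint (update q)) = ereal (Q.expectation ?A)"
    using kl_div_eq_integral_llr[OF prob_density_post[OF p] _ pos A] by simp
  moreover have "Q.expectation ?B = Q.expectation (llr (post p) (joint q))
      + Q.expectation (\<lambda>z. llr f (mix p) (fst z)) - Q.expectation (\<lambda>z. llr f (mix q) (fst z))"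
    using J(2) F(1) G(1) by simp
  ultimately show ?thesis
    using le J(3) F(2) G(2) by simp
qed

lemma kl_div_mix_update_le:
  assumes q: "admissible q"
  shows "kl_div M f (mix (update q)) \<le> kl_div M f (mix q)"
proof (cases "kl_div M f (mix q) < \<infinity>")
  case True
  have "kl_div (M \<Otimes>\<^sub>M N) (post q) (joint (update q)) + kl_div M f (mix q) \<le> kl_div M f (mix q) + kl_div M f (mix q)"
    using kl_div_post_update_le[OF q q _ True] kl_div_post_self[OF q True] True by simp
  \<comment> \<open>The common summand may be cancelled in \<open>ereal\<close> because it is
    finite.\<close>
  then have "kl_div (M \<Otimes>\<^sub>M N) (post q) (joint (update q)) \<le> kl_div M f (mix q)"
    using kl_div_mix_finiteD(2)[OF q q True]
    by (cases "kl_div (M \<Otimes>\<^sub>M N) (post q) (joint (update q))") auto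
  with kl_div_mix_le_kl_div_post[OF q admissible_update[OF q]] show ?thesis
    by (rule order_trans)
qed auto

lemma kl_div_iter_limit_le:
  fixes q :: "nat \<Rightarrow> 'b \<Rightarrow> ennreal"
  assumes p: "admissible p" and q0: "admissible (q 0)" and q_Suc: "\<And>m. q (Suc m) = update (q m)"
    and fin: "kl_div (M \<Otimes>\<^sub>M N) (post p) (joint (q m0)) < \<infinity>"
    and lim: "(\<lambda>m. kl_div M f (mix (q m))) \<longlonglongrightarrow> L"
  shows "L \<le> kl_div M f (mix p)"
proof (cases "kl_div M f (mix p) < \<infinity>")
  case True
  define d where "d m = kl_div M f (mix (q m))" for m
  define e where "e m = kl_div (M \<Otimes>\<^sub>M N) (post p) (joint (q m))" for m
  have adm: "admissible (q m)" for m
    by (induction m) (simp_all add: q0 q_Suc admissible_update)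
  note [measurable] = admissibleD(2)[OF adm]
  have d_le_e: "d m \<le> e m" for m
    unfolding d_def e_def by (rule kl_div_mix_le_kl_div_post[OF p adm])
  have d_nonneg: "0 \<le> d m" for m
    unfolding d_def using admissibleD(3)[OF adm]
    by (intro kl_div_nonneg[OF f_prob_density]) (auto simp: nn_integral_mix)
  have "decseq d"
    unfolding d_def by (rule decseq_SucI) (simp add: q_Suc kl_div_mix_update_le[OF adm])
  then have L: "L \<le> d m" for m
    using decseq_ge lim unfolding d_def by blast
  obtain D where D: "kl_div M f (mix p) = ereal D"
    using kl_div_mix_finiteD(2)[OF p p True] by blast
  have step: "e (Suc m) + d m \<le> e m + D" if "e m < \<infinity>" for m
    using kl_div_post_update_le[OF p adm that[unfolded e_def] True] by (simp add: d_def e_def q_Suc D)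
  have "0 \<le> L"
    using d_nonneg unfolding d_def by (intro LIMSEQ_le_const[OF lim]) blast
  moreover have "L < \<infinity>"
    using L[of m0] d_le_e[of m0] fin by (auto simp: e_def)
  ultimately obtain l where l: "L = ereal l" by (cases L) auto
  have e_nonneg: "0 \<le> e m" for m
    using d_le_e d_nonneg order_trans by blast
  obtain e0 where e0: "e m0 = ereal e0"
    using fin e_nonneg[of m0] by (cases "e m0") (auto simp: e_def)
  \<comment> \<open>Finiteness of \<open>e\<close> and the telescoped bound go through one
    induction, since each step needs the previous value finite. The constant \<open>l\<close>
    replaces every \<open>d\<close>, being a lower bound of the decreasing sequence.\<close>
  have sum: "\<exists>r. e (m0 + n) = ereal r \<and> r + n * l \<le> e0 + n * D" for n
  proof (induction n)
    case 0
    then show ?case by (simp add: e0)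
  next
    case (Suc n)
    then obtain r where r: "e (m0 + n) = ereal r" "r + n * l \<le> e0 + n * D" by blast
    have "e (m0 + Suc n) + ereal l \<le> e (m0 + Suc n) + d (m0 + n)"
      using L[of "m0 + n"] by (intro add_left_mono) (simp add: l)
    also have "\<dots> \<le> ereal (r + D)"
      using step[of "m0 + n"] by (simp add: r(1))
    finally obtain r' where "e (m0 + Suc n) = ereal r'" "r' + l \<le> r + D"
      using e_nonneg[of "m0 + Suc n"] by (cases "e (m0 + Suc n)") auto
    then show ?case
      using r(2) by (auto simp: algebra_simps)
  qed
  have "l \<le> D"
  proof (rule ccontr)
    assume "\<not> l \<le> D"
    \<comment> \<open>For this \<open>n\<close> the telescoped bound would make
      \<open>e (m0 + n)\<close> negative.\<close>
    then obtain n :: nat where "e0 < n * (l - D)"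
      using reals_Archimedean3[of "l - D"] by auto
    moreover obtain r where "e (m0 + n) = ereal r" "r + n * l \<le> e0 + n * D"
      using sum by blast
    moreover have "0 \<le> e (m0 + n)" by (rule e_nonneg)
    ultimately show False by (simp add: algebra_simps)
  qed
  then show ?thesis by (simp add: l D)
qed auto

end

section \<open>Convergence of the iteration\<close>

text \<open>The infimum ranges over all probability measures, in particular over the one with
  density \<open>q\<close>.\<close>

lemma inf_kl_le_kl_div_mixture_dens:
  fixes \<Theta> :: "'a::euclidean_space set"
  assumes k: "case_prod k \<in> borel_measurable (lborel_on X \<Otimes>\<^sub>M lborel_on \<Theta>)"
    and q: "prob_density (lborel_on \<Theta>) q"
  shows "inf_kl X \<Theta> k f \<le> kl_div (lborel_on X) f (mixture_dens (lborel_on \<Theta>) k q)"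
proof -
  note [measurable] = prob_densityD(1)[OF q]
  let ?P = "density (lborel_on \<Theta>) q"
  have "?P \<in> prob_measures_on \<Theta>"
    using prob_space_density_of_prob_density[OF q]
    by (simp add: prob_measures_on_def sets_restrict_space)
  then have "inf_kl X \<Theta> k f \<le> kl_div (lborel_on X) f (mixture k ?P)"
    unfolding inf_kl_def by (rule INF_lower)
  also have "mixture k ?P x = mixture_dens (lborel_on \<Theta>) k q x" if "x \<in> space (lborel_on X)" for x
  proof -
    have [measurable]: "k x \<in> borel_measurable (lborel_on \<Theta>)"
      using measurable_compose[OF measurable_Pair1'[OF that] k] by simp
    show ?thesis
      unfolding mixture_def mixture_dens_def by (simp add: nn_integral_density mult.commute)
  qed
  then have "kl_div (lborel_on X) f (mixture k ?P) = kl_div (lborel_on X) f (mixture_dens (lborel_on \<Theta>) k q)"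
    unfolding kl_div_def by (simp cong: nn_integral_cong)
  finally show ?thesis .
qed

theorem theorem3p1:
  fixes X :: "real set" and \<Theta> :: "'a::euclidean_space set"
    and k :: "real \<Rightarrow> 'a \<Rightarrow> ennreal" and f :: "real \<Rightarrow> ennreal"
    and p0 :: "'a \<Rightarrow> ennreal" and pstar :: "nat \<Rightarrow> 'a \<Rightarrow> ennreal"
  assumes X: "X \<in> sets borel" and \<Theta>: "\<Theta> \<in> sets borel"
    and f: "prob_density (lborel_on X) f"
    and k_meas: "(\<lambda>(x, \<theta>). k x \<theta>) \<in> borel_measurable (lborel_on X \<Otimes>\<^sub>M lborel_on \<Theta>)"
    and k_finite: "\<forall>x\<in>X. \<forall>\<theta>\<in>\<Theta>. k x \<theta> < \<infinity>"
    and k_dens: "\<forall>\<theta>\<in>\<Theta>. prob_density (lborel_on X) (\<lambda>x. k x \<theta>)"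
    and p0: "prob_density (lborel_on \<Theta>) p0" and p0_pos: "\<forall>\<theta>\<in>\<Theta>. p0 \<theta> > 0"
    and f0_pos: "AE x in lborel_on X. f x > 0 \<longrightarrow> f_iter (lborel_on X) (lborel_on \<Theta>) k f p0 0 x > 0"
    and pstar: "\<forall>s\<ge>1. prob_density (lborel_on \<Theta>) (pstar s)"
    and fstar_pos: "\<forall>s\<ge>1. AE x in lborel_on X. f x > 0 \<longrightarrow> mixture_dens (lborel_on \<Theta>) k (pstar s) x > 0"
    and i: "(\<lambda>s. kl_div (lborel_on X) f (mixture_dens (lborel_on \<Theta>) k (pstar s)))
              \<longlonglongrightarrow> inf_kl X \<Theta> k f"
    and ii: "\<forall>s\<ge>1. \<exists>m. kl_div (lborel_on X \<Otimes>\<^sub>M lborel_on \<Theta>)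
                         (pi_star (lborel_on \<Theta>) k f (pstar s))
                         (q_iter (lborel_on X) (lborel_on \<Theta>) k f p0 m) < \<infinity>"
  shows "decseq (\<lambda>m. kl_div (lborel_on X) f (f_iter (lborel_on X) (lborel_on \<Theta>) k f p0 m)) \<and>
         (\<lambda>m. kl_div (lborel_on X) f (f_iter (lborel_on X) (lborel_on \<Theta>) k f p0 m))
           \<longlonglongrightarrow> inf_kl X \<Theta> k f"
proof -
  let ?M = "lborel_on X" and ?N = "lborel_on \<Theta>"
  interpret M: sigma_finite_measure ?M
    using X by (intro sigma_finite_measure_restrict_space sigma_finite_lborel) simp
  interpret N: sigma_finite_measure ?N
    using \<Theta> by (intro sigma_finite_measure_restrict_space sigma_finite_lborel) simp
  interpret kernel_mixture ?M ?N k f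
    using k_meas k_finite k_dens f by unfold_locales (auto simp: space_restrict_space)
  define q where "q = p_iter ?M ?N k f p0"
  have q_Suc: "q (Suc m) = update (q m)" for m
    by (simp add: q_def ratio_def)
  have f_iter_eq: "f_iter ?M ?N k f p0 m = mix (q m)" for m
    by (simp add: q_def f_iter_def)
  have q_iter_eq: "q_iter ?M ?N k f p0 m = joint (q m)" for m
    by (simp add: q_def q_iter_def)
  have q0: "admissible (q 0)"
    using p0 f0_pos by (simp add: admissible_def f_iter_eq) (simp add: q_def)
  \<comment> \<open>Positivity of the later mixtures is inherited from that of the first
    one.\<close>
  have adm: "admissible (q m)" for m
    by (induction m) (simp_all add: q0 q_Suc admissible_update)
  have adm_star: "admissible (pstar s)" if "s \<ge> 1" for s
    using that pstar fstar_pos by (simp add: admissible_def)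
  let ?d = "\<lambda>m. kl_div ?M f (mix (q m))"
  have dec: "decseq ?d"
    by (rule decseq_SucI) (simp add: q_Suc kl_div_mix_update_le[OF adm])
  obtain L where L: "?d \<longlonglongrightarrow> L"
    using LIMSEQ_INF[OF dec] by blast
  have "L \<le> kl_div ?M f (mix (pstar s))" if s: "s \<ge> 1" for s
  proof -
    obtain m where "kl_div (?M \<Otimes>\<^sub>M ?N) (post (pstar s)) (joint (q m)) < \<infinity>"
      using ii s q_iter_eq by metis
    from kl_div_iter_limit_le[where q=q, OF adm_star[OF s] q0 q_Suc this L] show ?thesis .
  qed
  \<comment> \<open>The bound holds from \<open>s = 1\<close> on, which suffices for passing to the
    limit in \<open>s\<close>.\<close>
  then have "L \<le> inf_kl X \<Theta> k f"
    by (intro LIMSEQ_le_const[OF i]) blast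
  moreover have "inf_kl X \<Theta> k f \<le> L"
    using inf_kl_le_kl_div_mixture_dens[OF k_meas admissibleD(1)[OF adm]]
    by (intro LIMSEQ_le_const[OF L]) blast
  ultimately show ?thesis
    using dec L by (simp add: f_iter_eq)
qed

end
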